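(* Let $\widehat{\xi}_1,\ldots,\widehat{\xi}_T\in\Xi$ be observations and $\lambda\ge 0$. Let $x$ be an optimal solution to problem (R) given in the context, and let $\mu$ be the path constant associated with $x$ (defined in the context). Then for each component $C$ in $x$, $$|C|\,\bigl(\mu+\lambda D_{\max}(C)\bigr)^{-1}\ \le\ M(C)\ \le\ |C|\,\mu^{-1},$$ where $D_{\max}(C):=\max_{\ell\in[L]}\{D(P_\ell):P_\ell\subseteq C\}$ and $M(C):=\sum_{i\in C}x(0,i)$ is the total probability mass of the component.
   Context: $\Xi$ is a closed subset of $\mathbb{R}^m$ and $d$ is a metric on $\Xi$ such that $(\Xi,d)$ is a Polish metric space and $d$ is lower semicontinuous. $[T]=\{1,\ldots,T\}$, and $d(i,j):=d(\widehat{\xi}_i,\widehat{\xi}_j)$ for $i,j\in[T]$. Convention: $\log(0):=-\infty$. Problem (R): over variables $x(i,j)\ge 0$, $i\in\{0\}\cup[T]$, $j\in[T+1]$ (node $0$ is a source and node $T+1$ a sink), $$\text{maximize}\quad\sum_{j=1}^{T}\log\Bigl(\sum_{i=0}^{T}x(i,j)\Bigr)-\lambda\sum_{j=1}^{T}\sum_{i=1}^{T}d(i,j)x(i,j)$$ subject to $\sum_{j=1}^{T}x(0,j)=1$; $\sum_{i=0}^{T}x(i,j)=\sum_{k=1}^{T+1}x(j,k)$ for $j\in[T]$; $x(i,j)=0$ for $i\in[T]$, $j\in[i]$; and $x(0,T+1)=0$. Components: a feasible solution $x$ defines an undirected graph on the nodes $\{1,\ldots,T\}$ in which $i,j$ are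 joined when $x(i,j)>0$ or $x(j,i)>0$; a component $C\subseteq[T]$ in $x$ is (the node set of) a connected component of this graph. Paths: $P_1,\ldots,P_L\subseteq[T]$ are all the possible paths between source and sink, with source and sink omitted; i.e. all nonempty subsets of $[T]$ listed in increasing order. Write $(j,k)\in P_\ell$ if $j,k$ appear as successive elements of $P_\ell$, and $D(P_\ell):=\sum_{(j,k)\in P_\ell}d(j,k)$ (zero for one-element paths). $N(j)\subseteq[L]$ is the set of (indices of) paths that include node $j$. A flow decomposition of a feasible $x$ is $f_1,\ldots,f_L\in[0,1]$ with $\sum_\ell f_\ell=1$ such that $x(j,k)=\sum_{i:(j,k)\in P_i}f_i$ for $j,k\in[T]$, $x(0,j)$ is the sum of $f_i$ over paths with first element $j$, and $x(k,T+1)$ is the sum of $f_i$ over paths with last element $k$. Path constant: for an optimal $x$ with flow decomposition $f_1,\ldots,f_L$, $\mu$ is a constant such that for every $\ell\in[L]$, $$\sum_{j\in P_\ell}\Bigl(\sum_{i\in N(j)}f_i\Bigr)^{-1}-\lambda D(P_\ell)\le\mu,$$ with equality if $f_\ell>0$. (Such a constant exists for every optimal $x$.) *)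

theory Defs
  imports "HOL-Analysis.Analysis"
begin

definition lower_semicontinuous_on :: "'a::topological_space set \<Rightarrow> ('a \<Rightarrow> real) \<Rightarrow> bool" where
  "lower_semicontinuous_on S f \<longleftrightarrow>
     (\<forall>p\<in>S. \<forall>a<f p. \<forall>\<^sub>F q in at p within S. a < f q)"

text \<open>Completeness and separability refer to the topology induced by \<open>d\<close>,
  not to the Euclidean one. The locale \<open>Metric_space\<close> also requires the total function \<open>d\<close>
  to be nonnegative and symmetric outside of \<open>X\<close>; this restricts only irrelevant values.\<close>

definition polish_metric_space :: "'a set \<Rightarrow> ('a \<Rightarrow> 'a \<Rightarrow> real) \<Rightarrow> bool" where
  "polish_metric_space X d \<longleftrightarrow>
     Metric_space X d \<and> Metric_space.mcomplete X d \<and>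
     separable_space (Metric_space.mtopology X d)"

definition obs_dist :: "('a \<Rightarrow> 'a \<Rightarrow> real) \<Rightarrow> (nat \<Rightarrow> 'a) \<Rightarrow> nat \<Rightarrow> nat \<Rightarrow> real" where
  "obs_dist d \<xi> i j = d (\<xi> i) (\<xi> j)"

text \<open>A flow \<open>x\<close> is a function of two natural numbers, of which only the values \<open>x i j\<close> with
  \<open>i \<in> {0..T}\<close> and \<open>j \<in> {1..T + 1}\<close> matter; node \<open>0\<close> is the source, node \<open>T + 1\<close> the sink.
  In the objective, \<open>c i j\<close> is the distance between observations \<open>i\<close> and \<open>j\<close>.\<close>

definition feasible :: "nat \<Rightarrow> (nat \<Rightarrow> nat \<Rightarrow> real) \<Rightarrow> bool" where
  "feasible T x \<longleftrightarrow>
     (\<forall>i\<in>{0..T}. \<forall>j\<in>{1..T + 1}. 0 \<le> x i j) \<and>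
     (\<Sum>j=1..T. x 0 j) = 1 \<and>
     (\<forall>j\<in>{1..T}. (\<Sum>i=0..T. x i j) = (\<Sum>k=1..T + 1. x j k)) \<and>
     (\<forall>i\<in>{1..T}. \<forall>j\<in>{1..i}. x i j = 0) \<and>
     x 0 (T + 1) = 0"

text \<open>Logarithm with \<open>log 0 = -\<infinity>\<close>; HOL's \<open>ln 0\<close> is not suitable.
  Only nonnegative arguments occur.\<close>

definition elog :: "real \<Rightarrow> ereal" where
  "elog s = (if s = 0 then - \<infinity> else ereal (ln s))"

definition objective :: "nat \<Rightarrow> (nat \<Rightarrow> nat \<Rightarrow> real) \<Rightarrow> real \<Rightarrow> (nat \<Rightarrow> nat \<Rightarrow> real) \<Rightarrow> ereal" where
  "objective T c lam x =
     (\<Sum>j=1..T. elog (\<Sum>i=0..T. x i j)) - ereal (lam * (\<Sum>j=1..T. \<Sum>i=1..T. c i j * x i j))"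

definition optimal :: "nat \<Rightarrow> (nat \<Rightarrow> nat \<Rightarrow> real) \<Rightarrow> real \<Rightarrow> (nat \<Rightarrow> nat \<Rightarrow> real) \<Rightarrow> bool" where
  "optimal T c lam x \<longleftrightarrow>
     feasible T x \<and> (\<forall>y. feasible T y \<longrightarrow> objective T c lam y \<le> objective T c lam x)"

definition support_edges :: "nat \<Rightarrow> (nat \<Rightarrow> nat \<Rightarrow> real) \<Rightarrow> (nat \<times> nat) set" where
  "support_edges T x = {(i, j) \<in> {1..T} \<times> {1..T}. x i j > 0 \<or> x j i > 0}"

definition flow_components :: "nat \<Rightarrow> (nat \<Rightarrow> nat \<Rightarrow> real) \<Rightarrow> nat set set" where
  "flow_components T x = {1..T} // {(i, j) \<in> {1..T} \<times> {1..T}. (i, j) \<in> (support_edges T x)\<^sup>*}"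

text \<open>A source-sink path, with source and sink omitted, is identified with its set of nodes,
  which it visits in increasing order. \<open>P\<close> enumerates all paths without repetition.\<close>

definition path_enumeration :: "nat \<Rightarrow> nat \<Rightarrow> (nat \<Rightarrow> nat set) \<Rightarrow> bool" where
  "path_enumeration T L P \<longleftrightarrow> bij_betw P {1..L} (Pow {1..T} - {{}})"

definition path_arcs :: "nat set \<Rightarrow> (nat \<times> nat) set" where
  "path_arcs p = {(j, k) \<in> p \<times> p. j < k \<and> (\<forall>l\<in>p. l \<le> j \<or> k \<le> l)}"

definition path_cost :: "(nat \<Rightarrow> nat \<Rightarrow> real) \<Rightarrow> nat set \<Rightarrow> real" where
  "path_cost c p = (\<Sum>(j, k)\<in>path_arcs p. c j k)"

definition paths_through :: "nat \<Rightarrow> (nat \<Rightarrow> nat set) \<Rightarrow> nat \<Rightarrow> nat set" where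
  "paths_through L P j = {i \<in> {1..L}. j \<in> P i}"

definition flow_decomposition ::
  "nat \<Rightarrow> nat \<Rightarrow> (nat \<Rightarrow> nat set) \<Rightarrow> (nat \<Rightarrow> nat \<Rightarrow> real) \<Rightarrow> (nat \<Rightarrow> real) \<Rightarrow> bool" where
  "flow_decomposition T L P x f \<longleftrightarrow>
     (\<forall>l\<in>{1..L}. f l \<in> {0..1}) \<and>
     (\<Sum>l=1..L. f l) = 1 \<and>
     (\<forall>j\<in>{1..T}. \<forall>k\<in>{1..T}. x j k = (\<Sum>i\<in>{i\<in>{1..L}. (j, k) \<in> path_arcs (P i)}. f i)) \<and>
     (\<forall>j\<in>{1..T}. x 0 j = (\<Sum>i\<in>{i\<in>{1..L}. Min (P i) = j}. f i)) \<and>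
     (\<forall>k\<in>{1..T}. x k (T + 1) = (\<Sum>i\<in>{i\<in>{1..L}. Max (P i) = k}. f i))"

definition path_constant ::
  "nat \<Rightarrow> (nat \<Rightarrow> nat set) \<Rightarrow> (nat \<Rightarrow> nat \<Rightarrow> real) \<Rightarrow> real \<Rightarrow> (nat \<Rightarrow> real) \<Rightarrow> real \<Rightarrow> bool" where
  "path_constant L P c lam f \<mu> \<longleftrightarrow>
     (\<forall>l\<in>{1..L}.
        (let v = (\<Sum>j\<in>P l. inverse (\<Sum>i\<in>paths_through L P j. f i)) - lam * path_cost c (P l)
         in v \<le> \<mu> \<and> (f l > 0 \<longrightarrow> v = \<mu>)))"

definition D_max :: "nat \<Rightarrow> (nat \<Rightarrow> nat set) \<Rightarrow> (nat \<Rightarrow> nat \<Rightarrow> real) \<Rightarrow> nat set \<Rightarrow> real" where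
  "D_max L P c C = Max {path_cost c (P l) | l. l \<in> {1..L} \<and> P l \<subseteq> C}"

definition component_mass :: "(nat \<Rightarrow> nat \<Rightarrow> real) \<Rightarrow> nat set \<Rightarrow> real" where
  "component_mass x C = (\<Sum>i\<in>C. x 0 i)"

end

theory Submission
  imports Defs
begin

text \<open>Multiply the equality case of the path constant by \<open>f l\<close> and sum over the paths \<open>l\<close> inside
  a component \<open>C\<close>. A path that carries flow and meets \<open>C\<close> stays in \<open>C\<close>, so exchanging the sums
  turns the reciprocal masses into \<open>card C\<close>, and the result is
  \<open>card C = \<mu> * M C + lam * (\<Sum>l. f l * path_cost c (P l))\<close>, where the last sum lies between \<open>0\<close>
  and \<open>D_max C * M C\<close>. Optimality is used only to see that every node carries positive mass.\<close>

section \<open>Costs, paths and components\<close>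

lemma obs_dist_nonneg:
  assumes "polish_metric_space X d"
  shows "0 \<le> obs_dist d \<xi> i j"
  using assms by (auto simp: polish_metric_space_def obs_dist_def Metric_space.nonneg)

lemma path_cost_nonneg:
  assumes "\<And>i j. 0 \<le> c i j"
  shows "0 \<le> path_cost c p"
  unfolding path_cost_def by (rule sum_nonneg) (auto simp: assms)

lemma path_cost_singleton [simp]: "path_cost c {j} = 0"
proof -
  have "path_arcs {j} = {}"
    by (auto simp: path_arcs_def)
  then show ?thesis by (simp add: path_cost_def)
qed

text \<open>Each element other than the least is entered by an arc from its predecessor, the largest
  smaller element of \<open>p\<close>, so induction descends to \<open>Min p\<close>. This is what
  ties all nodes of a path to a single component.\<close>

lemma path_arcs_reach:
  assumes "finite p" "a \<in> p"
  shows "(Min p, a) \<in> (path_arcs p)\<^sup>*"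
  using assms(2)
proof (induction a rule: less_induct)
  case (less a)
  show ?case
  proof (cases "a = Min p")
    case False
    define S where "S = {b \<in> p. b < a}"
    have "Min p \<in> p" "Min p \<le> a"
      using less.prems assms(1) by (auto intro: Min_in)
    then have "S \<noteq> {}" "finite S"
      using False assms(1) by (auto simp: S_def)
    then have b: "Max S \<in> S" and ge: "\<And>l. l \<in> S \<Longrightarrow> l \<le> Max S"
      by auto
    have "l \<le> Max S \<or> a \<le> l" if "l \<in> p" for l
      using ge[of l] that by (auto simp: S_def not_le)
    then have "(Max S, a) \<in> path_arcs p"
      using b less.prems by (auto simp: path_arcs_def S_def)
    moreover have "(Min p, Max S) \<in> (path_arcs p)\<^sup>*"
      using b less.IH by (auto simp: S_def)
    ultimately show ?thesis by (rule rtrancl_into_rtrancl[rotated])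
  qed simp
qed

lemma equiv_support_closure:
  "equiv {1..T} {(i, j) \<in> {1..T} \<times> {1..T}. (i, j) \<in> (support_edges T x)\<^sup>*}"
proof (rule equivI)
  have "sym ((support_edges T x)\<^sup>*)"
    by (rule sym_rtrancl) (auto simp: sym_def support_edges_def)
  then show "sym {(i, j) \<in> {1..T} \<times> {1..T}. (i, j) \<in> (support_edges T x)\<^sup>*}"
    by (auto simp: sym_def)
  show "trans {(i, j) \<in> {1..T} \<times> {1..T}. (i, j) \<in> (support_edges T x)\<^sup>*}"
    by (rule transI) (auto intro: rtrancl_trans)
qed (auto simp: refl_on_def)

lemma component_subset: "C \<in> flow_components T x \<Longrightarrow> C \<subseteq> {1..T}"
  unfolding flow_components_def by (rule in_quotient_imp_subset[OF equiv_support_closure])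

lemma component_nonempty: "C \<in> flow_components T x \<Longrightarrow> C \<noteq> {}"
  unfolding flow_components_def by (rule in_quotient_imp_non_empty[OF equiv_support_closure])

section \<open>Inflow at the nodes of an optimal solution\<close>

lemma objective_uniform_flow_finite:
  assumes "T \<noteq> 0"
  shows "\<exists>y. feasible T y \<and> objective T c lam y \<noteq> - \<infinity>"
proof -
  \<comment> \<open>Each one-node path carries \<open>1 / T\<close>, so every node has positive
    inflow and no logarithm degenerates.\<close>
  define y :: "nat \<Rightarrow> nat \<Rightarrow> real" where
    "y i j = (if i = 0 \<and> j \<in> {1..T} \<or> i \<in> {1..T} \<and> j = T + 1 then 1 / T else 0)" for i j
  have into: "(\<Sum>i=0..T. y i j) = 1 / T" if "j \<in> {1..T}" for j
  proof -
    have "(\<Sum>i=0..T. y i j) = (\<Sum>i=0..T. if i = 0 then 1 / T else 0)"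
      using that by (intro sum.cong) (auto simp: y_def)
    then show ?thesis by simp
  qed
  have out: "(\<Sum>k=1..T + 1. y j k) = 1 / T" if "j \<in> {1..T}" for j
  proof -
    have "(\<Sum>k=1..T + 1. y j k) = (\<Sum>k=1..T + 1. if k = T + 1 then 1 / T else 0)"
      using that by (intro sum.cong) (auto simp: y_def)
    then show ?thesis by simp
  qed
  have "(\<Sum>j=1..T. y 0 j) = (\<Sum>j=1..T. 1 / T)"
    by (intro sum.cong) (auto simp: y_def)
  then have "feasible T y"
    unfolding feasible_def using into out assms by (auto simp: y_def)
  moreover have "(\<Sum>j=1..T. elog (\<Sum>i=0..T. y i j)) = ereal (\<Sum>j=1..T. ln (1 / T))"
    unfolding sum_ereal[symmetric] using into assms by (intro sum.cong) (auto simp: elog_def)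
  then have "objective T c lam y \<noteq> - \<infinity>"
    by (simp add: objective_def)
  ultimately show ?thesis by blast
qed

text \<open>A node without inflow would push the objective to \<open>- \<infinity>\<close>, strictly
  below that of the uniform flow.\<close>

lemma optimal_inflow_nonzero:
  assumes "optimal T c lam x" "j \<in> {1..T}"
  shows "(\<Sum>i=0..T. x i j) \<noteq> 0"
proof
  let ?g = "\<lambda>j. elog (\<Sum>i=0..T. x i j)"
  assume "(\<Sum>i=0..T. x i j) = 0"
  then have "?g j = - \<infinity>"
    by (simp add: elog_def)
  \<comment> \<open>In \<open>ereal\<close>, \<open>\<infinity>\<close> added to
    \<open>- \<infinity>\<close> gives \<open>\<infinity>\<close>; hence the other terms must be
    seen to avoid \<open>\<infinity>\<close> before one term can decide the sum.\<close>
  moreover have "sum ?g ({1..T} - {j}) \<noteq> \<infinity>"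
    by (auto simp: sum_Pinfty elog_def)
  ultimately have "sum ?g {1..T} = - \<infinity>"
    using assms(2) by (subst sum.remove[of _ j]) auto
  then have "objective T c lam x = - \<infinity>"
    by (simp add: objective_def)
  moreover obtain y where "feasible T y" "objective T c lam y \<noteq> - \<infinity>"
    using objective_uniform_flow_finite[of T c lam] assms(2) by auto
  ultimately show False
    using assms(1) by (auto simp: optimal_def)
qed

section \<open>Paths in a flow decomposition\<close>

context
  fixes T L :: nat and P :: "nat \<Rightarrow> nat set"
    and x :: "nat \<Rightarrow> nat \<Rightarrow> real" and f :: "nat \<Rightarrow> real"
  assumes enum: "path_enumeration T L P"
    and dec: "flow_decomposition T L P x f"
begin

lemma image_paths: "P ` {1..L} = Pow {1..T} - {{}}"
  using enum by (simp add: path_enumeration_def bij_betw_def)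

lemma path_subset: "l \<in> {1..L} \<Longrightarrow> P l \<subseteq> {1..T}"
  and path_nonempty: "l \<in> {1..L} \<Longrightarrow> P l \<noteq> {}"
  using imageI[of l "{1..L}" P] unfolding image_paths by blast+

lemma finite_path: "l \<in> {1..L} \<Longrightarrow> finite (P l)"
  by (rule finite_subset[OF path_subset]) auto

lemma Min_path: "l \<in> {1..L} \<Longrightarrow> Min (P l) \<in> P l"
  by (simp add: finite_path path_nonempty)

lemma singleton_path:
  assumes "j \<in> {1..T}"
  obtains l where "l \<in> {1..L}" "P l = {j}"
proof -
  have "{j} \<in> P ` {1..L}"
    using assms unfolding image_paths by simp
  then show ?thesis using that by blast
qed

lemma flow_nonneg: "l \<in> {1..L} \<Longrightarrow> 0 \<le> f l"
  using dec by (auto simp: flow_decomposition_def)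

text \<open>If all paths through \<open>j\<close> had flow 0, so would every arc into
  \<open>j\<close>, including the one from the source, and \<open>j\<close> would have no inflow.
  Positivity keeps the reciprocals in the path constant away from the default
  \<open>inverse 0 = 0\<close>.\<close>

lemma mass_pos:
  assumes "optimal T c lam x" "j \<in> {1..T}"
  shows "0 < (\<Sum>i\<in>paths_through L P j. f i)"
proof -
  have fin: "finite (paths_through L P j)"
    and nn: "\<And>l. l \<in> paths_through L P j \<Longrightarrow> 0 \<le> f l"
    using flow_nonneg by (auto simp: paths_through_def)
  have "(\<Sum>i\<in>paths_through L P j. f i) \<noteq> 0"
  proof
    assume "(\<Sum>i\<in>paths_through L P j. f i) = 0"
    then have z: "f l = 0" if "l \<in> {1..L}" "j \<in> P l" for l
      using that sum_nonneg_eq_0_iff[OF fin nn] by (auto simp: paths_through_def)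
    have "x i j = 0" if "i \<in> {0..T}" for i
    proof (cases "i = 0")
      case True
      have "x 0 j = (\<Sum>i\<in>{i\<in>{1..L}. Min (P i) = j}. f i)"
        using dec assms(2) by (simp add: flow_decomposition_def)
      also have "\<dots> = 0"
        using Min_path by (intro sum.neutral) (auto intro: z)
      finally show ?thesis using True by simp
    next
      case False
      then have "x i j = (\<Sum>l\<in>{l\<in>{1..L}. (i, j) \<in> path_arcs (P l)}. f l)"
        using dec assms(2) that by (simp add: flow_decomposition_def)
      also have "\<dots> = 0"
        by (intro sum.neutral) (auto intro: z simp: path_arcs_def)
      finally show ?thesis .
    qed
    then show False
      using optimal_inflow_nonzero[OF assms] by simp
  qed
  with sum_nonneg[OF nn] show ?thesis by (simp add: less_le)
qed

lemma path_arcs_subset_support: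
  assumes "l \<in> {1..L}" "0 < f l"
  shows "path_arcs (P l) \<subseteq> support_edges T x"
proof clarify
  fix j k assume jk: "(j, k) \<in> path_arcs (P l)"
  then have in_T: "j \<in> {1..T}" "k \<in> {1..T}"
    using path_subset[OF assms(1)] by (auto simp: path_arcs_def)
  \<comment> \<open>The flow on an arc is at least that of any single path using it.\<close>
  have "f l \<le> (\<Sum>i\<in>{i\<in>{1..L}. (j, k) \<in> path_arcs (P i)}. f i)"
    by (rule member_le_sum) (use assms jk flow_nonneg in auto)
  also have "\<dots> = x j k"
    using dec in_T by (simp add: flow_decomposition_def)
  finally show "(j, k) \<in> support_edges T x"
    using assms(2) in_T by (simp add: support_edges_def)
qed

text \<open>The arcs of a path carrying flow are support edges, so each of its nodes is equivalent
  to its first node, and any two nodes are equivalent through that one.\<close>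

lemma path_subset_component:
  assumes C: "C \<in> flow_components T x" and l: "l \<in> {1..L}" "0 < f l"
    and meets: "a \<in> P l" "a \<in> C"
  shows "P l \<subseteq> C"
proof
  fix b assume b: "b \<in> P l"
  define R where "R = {(i, j) \<in> {1..T} \<times> {1..T}. (i, j) \<in> (support_edges T x)\<^sup>*}"
  have R: "equiv {1..T} R"
    unfolding R_def by (rule equiv_support_closure)
  have "(Min (P l), u) \<in> R" if u: "u \<in> P l" for u
  proof -
    have "(Min (P l), u) \<in> (support_edges T x)\<^sup>*"
      using path_arcs_reach[OF finite_path[OF l(1)] u] rtrancl_mono[OF path_arcs_subset_support[OF l]]
      by (rule rev_subsetD)
    then show ?thesis
      using path_subset[OF l(1)] Min_path[OF l(1)] u unfolding R_def by auto
  qed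
  then have "(a, b) \<in> R"
    using meets(1) b R by (meson equivE symD transD)
  then show "b \<in> C"
    using in_quotient_imp_closed[OF R] C meets(2) unfolding flow_components_def R_def by blast
qed

text \<open>Source flow into \<open>C\<close> belongs to the paths that start in \<open>C\<close>.
  Those carrying flow stay in \<open>C\<close>, and every path inside \<open>C\<close> starts
  there.\<close>

lemma component_mass_eq:
  assumes C: "C \<in> flow_components T x"
  shows "component_mass x C = (\<Sum>l\<in>{l\<in>{1..L}. P l \<subseteq> C}. f l)"
proof -
  have sub: "C \<subseteq> {1..T}"
    using C by (rule component_subset)
  then have fin: "finite C" by (rule finite_subset) simp
  have "component_mass x C = (\<Sum>i\<in>C. \<Sum>l\<in>{l\<in>{1..L}. Min (P l) = i}. f l)"
    unfolding component_mass_def using dec sub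
    by (intro sum.cong) (auto simp: flow_decomposition_def)
  also have "\<dots> = (\<Sum>l=1..L. \<Sum>i\<in>{i\<in>C. Min (P l) = i}. f l)"
    by (rule sum.swap_restrict) (simp_all add: fin)
  also have "\<dots> = (\<Sum>l=1..L. if P l \<subseteq> C then f l else 0)"
  proof (rule sum.cong)
    fix l assume l: "l \<in> {1..L}"
    \<comment> \<open>A path may start in \<open>C\<close> and leave it, but only with flow 0, so
      both sides agree.\<close>
    have "P l \<subseteq> C" if "Min (P l) \<in> C" "f l \<noteq> 0"
      using path_subset_component[OF C l _ Min_path[OF l]] that flow_nonneg[OF l] by simp
    moreover have "{i\<in>C. Min (P l) = i} = (if Min (P l) \<in> C then {Min (P l)} else {})"
      by auto
    ultimately show "(\<Sum>i\<in>{i\<in>C. Min (P l) = i}. f l) = (if P l \<subseteq> C then f l else 0)"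
      using Min_path[OF l] by auto
  qed simp
  also have "\<dots> = (\<Sum>l\<in>{l\<in>{1..L}. P l \<subseteq> C}. f l)"
    by (rule sum.inter_filter[symmetric]) simp
  finally show ?thesis .
qed

section \<open>Balance and bounds for the mass of a component\<close>

lemma component_balance:
  assumes opt: "optimal T c lam x" and pc: "path_constant L P c lam f \<mu>"
    and C: "C \<in> flow_components T x"
  shows "real (card C) = \<mu> * component_mass x C
    + lam * (\<Sum>l\<in>{l\<in>{1..L}. P l \<subseteq> C}. f l * path_cost c (P l))"
proof -
  define K where "K = {l\<in>{1..L}. P l \<subseteq> C}"
  define p where "p j = (\<Sum>i\<in>paths_through L P j. f i)" for j
  have sub: "C \<subseteq> {1..T}"
    using C by (rule component_subset)
  then have fin: "finite C" by (rule finite_subset) simp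
  have finK: "finite K" by (simp add: K_def)
  have p_pos: "0 < p j" if "j \<in> C" for j
    using mass_pos[OF opt] that sub unfolding p_def by blast
  \<comment> \<open>Paths through \<open>j\<close> that leave \<open>C\<close> carry no flow, so the
    mass at \<open>j\<close> comes from paths in \<open>K\<close> alone.\<close>
  have p_K: "p j = (\<Sum>l\<in>{l\<in>K. j \<in> P l}. f l)" if "j \<in> C" for j
    unfolding p_def
  proof (rule sum.mono_neutral_right)
    show "\<forall>l\<in>paths_through L P j - {l\<in>K. j \<in> P l}. f l = 0"
    proof
      fix l assume l: "l \<in> paths_through L P j - {l\<in>K. j \<in> P l}"
      then have "l \<in> {1..L}" "j \<in> P l" "\<not> P l \<subseteq> C"
        by (auto simp: paths_through_def K_def)
      then show "f l = 0"
        using path_subset_component[OF C, of l j] flow_nonneg[of l] that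
        by (metis less_eq_real_def)
    qed
  qed (auto simp: paths_through_def K_def)
  \<comment> \<open>Each node counts 1, written as its mass times the reciprocal; after the exchange
    of sums these reciprocals collect along the paths.\<close>
  have "real (card C) = (\<Sum>j\<in>C. inverse (p j) * p j)"
    using p_pos by (simp add: less_imp_neq[symmetric])
  also have "\<dots> = (\<Sum>j\<in>C. \<Sum>l\<in>{l\<in>K. j \<in> P l}. f l * inverse (p j))"
    by (intro sum.cong refl) (simp add: p_K sum_distrib_right[symmetric] mult.commute)
  also have "\<dots> = (\<Sum>l\<in>K. \<Sum>j\<in>{j\<in>C. j \<in> P l}. f l * inverse (p j))"
    by (rule sum.swap_restrict) (simp_all add: fin finK)
  also have "\<dots> = (\<Sum>l\<in>K. f l * (\<mu> + lam * path_cost c (P l)))"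
  proof (rule sum.cong)
    fix l assume l: "l \<in> K"
    then have "{j\<in>C. j \<in> P l} = P l" by (auto simp: K_def)
    then have "(\<Sum>j\<in>{j\<in>C. j \<in> P l}. f l * inverse (p j)) = f l * (\<Sum>j\<in>P l. inverse (p j))"
      by (simp add: sum_distrib_left)
    also have "\<dots> = f l * (\<mu> + lam * path_cost c (P l))"
    \<comment> \<open>The path constant gives an equation only when \<open>f l > 0\<close>;
      otherwise the factor \<open>f l\<close> makes both sides vanish.\<close>
    proof (cases "f l = 0")
      case False
      then have "0 < f l" using flow_nonneg[of l] l by (auto simp: K_def)
      then have "(\<Sum>j\<in>P l. inverse (p j)) - lam * path_cost c (P l) = \<mu>"
        using pc l unfolding path_constant_def Let_def p_def K_def by blast
      then show ?thesis by (simp add: algebra_simps)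
    qed simp
    finally show "(\<Sum>j\<in>{j\<in>C. j \<in> P l}. f l * inverse (p j))
      = f l * (\<mu> + lam * path_cost c (P l))" .
  qed simp
  also have "\<dots> = \<mu> * (\<Sum>l\<in>K. f l) + lam * (\<Sum>l\<in>K. f l * path_cost c (P l))"
    by (simp add: algebra_simps sum.distrib sum_distrib_left)
  finally show ?thesis
    unfolding component_mass_eq[OF C] K_def .
qed

text \<open>Both bounds divide an estimate of \<open>component_balance\<close>, so the denominators
  \<open>\<mu>\<close> and \<open>\<mu> + lam * D\<close> must first be shown positive.\<close>

lemma component_mass_bounds:
  assumes opt: "optimal T c lam x" and pc: "path_constant L P c lam f \<mu>"
    and c: "\<And>i j. 0 \<le> c i j" and lam: "0 \<le> lam" and C: "C \<in> flow_components T x"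
  shows "real (card C) * inverse (\<mu> + lam * D_max L P c C) \<le> component_mass x C"
    and "component_mass x C \<le> real (card C) * inverse \<mu>"
proof -
  define K where "K = {l\<in>{1..L}. P l \<subseteq> C}"
  define D where "D = D_max L P c C"
  have D_ge: "path_cost c (P l) \<le> D" if "l \<in> K" for l
    unfolding D_def D_max_def using that by (intro Max_ge) (auto simp: K_def)
  \<comment> \<open>A one-node path has cost 0, so its inequality bounds \<open>\<mu>\<close> below
    by the positive reciprocal of the mass at \<open>j\<close>. The same path lies in
    \<open>C\<close> and gives \<open>0 \<le> D\<close>.\<close>
  obtain j where j: "j \<in> C" "j \<in> {1..T}"
    using component_subset[OF C] component_nonempty[OF C] by blast
  then obtain l where l: "l \<in> {1..L}" "P l = {j}"
    using singleton_path by blast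
  have "(\<Sum>j\<in>P l. inverse (\<Sum>i\<in>paths_through L P j. f i)) - lam * path_cost c (P l) \<le> \<mu>"
    using pc l(1) unfolding path_constant_def Let_def by blast
  then have "inverse (\<Sum>i\<in>paths_through L P j. f i) \<le> \<mu>"
    by (simp add: l(2))
  then have \<mu>: "0 < \<mu>"
    using positive_imp_inverse_positive[OF mass_pos[OF opt j(2)]] by linarith
  have "0 \<le> D"
    using D_ge[of l] l j(1) by (simp add: K_def)
  then have pos: "0 < \<mu> + lam * D"
    using \<mu> lam by (simp add: add_pos_nonneg)
  have bal: "real (card C) = \<mu> * component_mass x C + lam * (\<Sum>l\<in>K. f l * path_cost c (P l))"
    unfolding K_def by (rule component_balance[OF opt pc C])
  have "0 \<le> (\<Sum>l\<in>K. f l * path_cost c (P l))"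
    by (intro sum_nonneg mult_nonneg_nonneg flow_nonneg path_cost_nonneg c) (simp add: K_def)
  then have "\<mu> * component_mass x C \<le> real (card C)"
    using bal lam by simp
  then show "component_mass x C \<le> real (card C) * inverse \<mu>"
    using \<mu> by (simp add: field_simps)
  have "(\<Sum>l\<in>K. f l * path_cost c (P l)) \<le> (\<Sum>l\<in>K. f l * D)"
    using D_ge flow_nonneg by (intro sum_mono mult_left_mono) (auto simp: K_def)
  also have "\<dots> = D * component_mass x C"
    unfolding component_mass_eq[OF C] K_def sum_distrib_right[symmetric] by (rule mult.commute)
  finally have "real (card C) \<le> \<mu> * component_mass x C + lam * (D * component_mass x C)"
    using bal lam by (simp add: mult_left_mono)
  then show "real (card C) * inverse (\<mu> + lam * D_max L P c C) \<le> component_mass x C"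
    using pos unfolding D_def[symmetric] by (simp add: field_simps)
qed

end

theorem proposition4:
  fixes \<Xi> :: "(real ^ 'm) set" and d :: "real ^ 'm \<Rightarrow> real ^ 'm \<Rightarrow> real"
    and T :: nat and \<xi> :: "nat \<Rightarrow> real ^ 'm" and lam :: real
    and L :: nat and P :: "nat \<Rightarrow> nat set"
    and x :: "nat \<Rightarrow> nat \<Rightarrow> real" and f :: "nat \<Rightarrow> real" and \<mu> :: real
  assumes "closed \<Xi>"
    and "polish_metric_space \<Xi> d"
    and "lower_semicontinuous_on (\<Xi> \<times> \<Xi>) (\<lambda>(u, v). d u v)"
    and "\<forall>i\<in>{1..T}. \<xi> i \<in> \<Xi>"
    and "lam \<ge> 0"
    and "path_enumeration T L P"
    and "optimal T (obs_dist d \<xi>) lam x"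
    and "flow_decomposition T L P x f"
    and "path_constant L P (obs_dist d \<xi>) lam f \<mu>"
  shows "\<forall>C\<in>flow_components T x.
    real (card C) * inverse (\<mu> + lam * D_max L P (obs_dist d \<xi>) C) \<le> component_mass x C \<and>
    component_mass x C \<le> real (card C) * inverse \<mu>"
  using component_mass_bounds[OF assms(6,8,7,9) obs_dist_nonneg[OF assms(2)] assms(5)] by blast

end
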